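(* (i) For every finite simple graph $G$, $\mathrm{diadem}(G)\subseteq\mathrm{corona}(G)$; if $G$ is a König–Egerváry graph, then $\mathrm{diadem}(G)=\mathrm{corona}(G)$. (ii) If $G$ is a König–Egerváry graph, then $|\ker(G)|+|\mathrm{diadem}(G)|\le 2\alpha(G)$.
   Context: For $X\subseteq V(G)$, $N(X)$ is the set of vertices adjacent to some vertex of $X$ and $d(X)=|X|-|N(X)|$. An independent set $A$ is a critical independent set if $d(A)=\max\{d(I): I \text{ independent in } G\}$. $\ker(G)$ is the intersection and $\mathrm{diadem}(G)$ the union of all critical independent sets of $G$. $\alpha(G)$ is the independence number, $\Omega(G)$ the family of maximum independent sets, $\mathrm{corona}(G)=\bigcup\Omega(G)$. $\mu(G)$ is the matching number; $G$ is König–Egerváry if $\alpha(G)+\mu(G)=|V(G)|$. *)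

theory Defs
  imports "Graph_Theory.Pair_Digraph"
begin

text \<open>
  A finite simple graph is a record \<open>G\<close> with \<^const>\<open>pair_graph\<close> \<open>G\<close>: finitely many vertices and a
  symmetric, loop-free set of arcs. An undirected edge \<open>uv\<close> is thus represented by the two arcs
  \<open>(u, v)\<close> and \<open>(v, u)\<close>; \<open>edge_set\<close> identifies them, so that matchings count undirected edges.
\<close>

definition edge_set :: "'a pair_pre_digraph \<Rightarrow> 'a set set" where
  "edge_set G = {{u, v} | u v. (u, v) \<in> parcs G}"

definition nbhd :: "'a pair_pre_digraph \<Rightarrow> 'a set \<Rightarrow> 'a set" where
  "nbhd G X = {v \<in> pverts G. \<exists>u\<in>X. (u, v) \<in> parcs G}"

definition difference :: "'a pair_pre_digraph \<Rightarrow> 'a set \<Rightarrow> int" where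
  "difference G X = int (card X) - int (card (nbhd G X))"

definition independent_set :: "'a pair_pre_digraph \<Rightarrow> 'a set \<Rightarrow> bool" where
  "independent_set G A \<longleftrightarrow> A \<subseteq> pverts G \<and> (\<forall>u\<in>A. \<forall>v\<in>A. (u, v) \<notin> parcs G)"

definition critical_independent_set :: "'a pair_pre_digraph \<Rightarrow> 'a set \<Rightarrow> bool" where
  "critical_independent_set G A \<longleftrightarrow>
     independent_set G A \<and> difference G A = Max {difference G I | I. independent_set G I}"

definition graph_ker :: "'a pair_pre_digraph \<Rightarrow> 'a set" where
  "graph_ker G = \<Inter>{A. critical_independent_set G A}"

definition diadem :: "'a pair_pre_digraph \<Rightarrow> 'a set" where
  "diadem G = \<Union>{A. critical_independent_set G A}"

definition independence_number :: "'a pair_pre_digraph \<Rightarrow> nat" where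
  "independence_number G = Max {card I | I. independent_set G I}"

definition maximum_independent_sets :: "'a pair_pre_digraph \<Rightarrow> 'a set set" where
  "maximum_independent_sets G = {I. independent_set G I \<and> card I = independence_number G}"

definition corona :: "'a pair_pre_digraph \<Rightarrow> 'a set" where
  "corona G = \<Union>(maximum_independent_sets G)"

definition graph_matching :: "'a pair_pre_digraph \<Rightarrow> 'a set set \<Rightarrow> bool" where
  "graph_matching G M \<longleftrightarrow> M \<subseteq> edge_set G \<and> (\<forall>e\<in>M. \<forall>f\<in>M. e \<noteq> f \<longrightarrow> e \<inter> f = {})"

definition matching_number :: "'a pair_pre_digraph \<Rightarrow> nat" where
  "matching_number G = Max {card M | M. graph_matching G M}"

definition Koenig_Egervary :: "'a pair_pre_digraph \<Rightarrow> bool" where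
  "Koenig_Egervary G \<longleftrightarrow> independence_number G + matching_number G = card (pverts G)"

end

theory Submission
  imports Defs
begin

text \<open>
  If \<open>A\<close> is critical and \<open>S\<close> is a maximum independent set, comparing \<open>d(A \<inter> S)\<close> with \<open>d(A)\<close> gives
  \<open>|S \<inter> N(A)| \<le> |A - S|\<close>, so the independent set \<open>A \<union> (S - N(A))\<close> is maximum and contains \<open>A\<close>.

  In a Koenig-Egervary graph, a maximum matching restricts to an injection \<open>f\<close> of \<open>V - S\<close> into \<open>S\<close>
  along edges. Counting with \<open>f\<close> yields \<open>d(I) \<le> |S| - |V - S| \<le> d(S)\<close> for every independent set
  \<open>I\<close>, so maximum independent sets are critical. Moreover, if \<open>v \<notin> S\<close> lies in a maximum independent
  set \<open>T\<close>, then \<open>f v \<notin> T\<close> and hence \<open>f v\<close> is outside the kernel; thus \<open>f\<close> injects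
  \<open>diadem - S\<close> into \<open>S - ker\<close>.
\<close>

section \<open>Maxima over finite families of vertex sets and matchings\<close>

lemma Max_image_attained:
  assumes "finite {x. P x}" and "P y"
  obtains x where "P x" "f x = Max {f x | x. P x}"
proof -
  have "{f x | x. P x} = f ` {x. P x}" by auto
  with assms have "finite {f x | x. P x}" "{f x | x. P x} \<noteq> {}" by auto
  from Max_in[OF this] show ?thesis using that by auto
qed

lemma le_Max_image:
  fixes f :: "'a \<Rightarrow> 'b::linorder"
  assumes "finite {x. P x}" and "P y"
  shows "f y \<le> Max {f x | x. P x}"
proof -
  have "{f x | x. P x} = f ` {x. P x}" by auto
  with assms show ?thesis by (intro Max_ge) auto
qed

lemma finite_independent_sets:
  assumes "finite (pverts G)"
  shows "finite {I. independent_set G I}"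
  by (rule finite_subset[of _ "Pow (pverts G)"]) (use assms in \<open>auto simp: independent_set_def\<close>)

lemma independent_set_empty: "independent_set G {}"
  by (simp add: independent_set_def)

lemma independent_set_subset:
  "independent_set G A \<Longrightarrow> B \<subseteq> A \<Longrightarrow> independent_set G B"
  by (auto simp: independent_set_def)

lemma card_le_independence_number:
  assumes "finite (pverts G)" "independent_set G I"
  shows "card I \<le> independence_number G"
  unfolding independence_number_def
  by (rule le_Max_image[OF finite_independent_sets]) (use assms in auto)

lemma maximum_independent_set_exists:
  assumes "finite (pverts G)"
  obtains S where "S \<in> maximum_independent_sets G"
proof -
  obtain S where "independent_set G S" "card S = independence_number G"
    using Max_image_attained[OF finite_independent_sets[OF assms] independent_set_empty,
        where f = card]
    unfolding independence_number_def by blast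
  then show ?thesis using that by (simp add: maximum_independent_sets_def)
qed

lemma critical_independent_set_iff:
  assumes "finite (pverts G)"
  shows "critical_independent_set G A \<longleftrightarrow>
    independent_set G A \<and> (\<forall>I. independent_set G I \<longrightarrow> difference G I \<le> difference G A)"
proof -
  \<comment> \<open>The maximiser \<open>B\<close> converts domination of every independent set into
    equality with \<open>Max\<close>.\<close>
  obtain B where "independent_set G B"
    "difference G B = Max {difference G I | I. independent_set G I}"
    by (rule Max_image_attained[OF finite_independent_sets[OF assms] independent_set_empty,
        where f = "difference G"])
  moreover have "difference G I \<le> Max {difference G I | I. independent_set G I}"
    if "independent_set G I" for I
    by (rule le_Max_image[OF finite_independent_sets[OF assms] that])
  ultimately show ?thesis
    unfolding critical_independent_set_def by (metis order_antisym)
qed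

lemma maximum_matching_exists:
  assumes "finite (parcs G)"
  obtains M where "graph_matching G M" "card M = matching_number G"
proof -
  have "edge_set G = (\<lambda>(u, v). {u, v}) ` parcs G"
    by (auto simp: edge_set_def)
  with assms have "finite (edge_set G)" by simp
  moreover have "{M. graph_matching G M} \<subseteq> Pow (edge_set G)"
    by (auto simp: graph_matching_def)
  ultimately have "finite {M. graph_matching G M}"
    by (meson finite_Pow_iff finite_subset)
  moreover have "graph_matching G {}"
    by (simp add: graph_matching_def)
  ultimately show ?thesis
    using Max_image_attained[where f = card and P = "graph_matching G"] that
    unfolding matching_number_def by blast
qed

section \<open>Enlarging critical sets to maximum independent sets\<close>

context pair_graph
begin

lemma critical_independent_set_extends:
  assumes A: "critical_independent_set G A" and S: "S \<in> maximum_independent_sets G"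
  shows "A \<union> (S - nbhd G A) \<in> maximum_independent_sets G"
proof -
  note fin = pair_finite_verts
  from A have A: "independent_set G A"
    and A_max: "\<And>I. independent_set G I \<Longrightarrow> difference G I \<le> difference G A"
    by (auto simp: critical_independent_set_iff[OF fin])
  from S have S: "independent_set G S" and card_S: "card S = independence_number G"
    by (auto simp: maximum_independent_sets_def)
  have "A \<subseteq> pverts G" "S \<subseteq> pverts G" "nbhd G A \<subseteq> pverts G"
    using A S by (auto simp: independent_set_def nbhd_def)
  then have fins: "finite A" "finite S" "finite (nbhd G A)"
    using finite_subset[OF _ fin] by blast+
  let ?B = "A \<union> (S - nbhd G A)"
  have B: "independent_set G ?B"
    using A S arcs_symmetric unfolding independent_set_def nbhd_def by blast
  \<comment> \<open>Independence of \<open>S\<close> keeps the neighbours of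
    \<open>A \<inter> S\<close> out of \<open>S\<close>. Criticality then gives |A \<inter> S| -
    |N(A) - S| \<le> |A| - |N(A)|, which rearranges to |S \<inter> N(A)| \<le> |A - S|.\<close>
  have "nbhd G (A \<inter> S) \<subseteq> nbhd G A - S"
    using S unfolding independent_set_def nbhd_def by blast
  then have "card (nbhd G (A \<inter> S)) \<le> card (nbhd G A - S)"
    using fins by (intro card_mono) auto
  moreover have "difference G (A \<inter> S) \<le> difference G A"
    by (rule A_max[OF independent_set_subset[OF A]]) simp
  moreover have "card (nbhd G A) = card (nbhd G A \<inter> S) + card (nbhd G A - S)"
    and "card A = card (A \<inter> S) + card (A - S)"
    and cS: "card S = card (S \<inter> nbhd G A) + card (S - nbhd G A)"
    using card_Int_Diff fins by blast+
  ultimately have "card (S \<inter> nbhd G A) \<le> card (A - S)"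
    unfolding difference_def by (simp add: Int_commute)
  moreover have "card ?B = card (A - S) + card (S - nbhd G A)"
  proof -
    \<comment> \<open>\<open>A\<close> is independent, so it misses its own neighbourhood and
      \<open>A \<inter> S\<close> survives inside \<open>S - nbhd G A\<close>.\<close>
    have "?B = (A - S) \<union> (S - nbhd G A)"
      using A unfolding independent_set_def nbhd_def by blast
    moreover have "(A - S) \<inter> (S - nbhd G A) = {}" by blast
    ultimately show ?thesis using fins card_Un_disjoint[of "A - S"] by simp
  qed
  ultimately have "card ?B \<ge> independence_number G"
    using cS card_S by simp
  with B card_le_independence_number[OF fin B] show ?thesis
    by (simp add: maximum_independent_sets_def)
qed

lemma diadem_subset_corona: "diadem G \<subseteq> corona G"
proof -
  obtain S where "S \<in> maximum_independent_sets G"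
    using maximum_independent_set_exists[OF pair_finite_verts] .
  then show ?thesis
    using critical_independent_set_extends unfolding diadem_def corona_def by blast
qed

section \<open>Maximum matchings in Koenig-Egervary graphs\<close>

lemma Koenig_Egervary_matching_injection:
  assumes KE: "Koenig_Egervary G" and S: "S \<in> maximum_independent_sets G"
  obtains f where "inj_on f (pverts G - S)" "f ` (pverts G - S) \<subseteq> S"
    "\<And>v. v \<in> pverts G - S \<Longrightarrow> (v, f v) \<in> parcs G"
proof -
  from S have S: "independent_set G S" and card_S: "card S = independence_number G"
    by (auto simp: maximum_independent_sets_def)
  note fin = pair_finite_verts
  have SV: "S \<subseteq> pverts G"
    using S by (auto simp: independent_set_def)
  obtain M where M: "graph_matching G M" and card_M: "card M = matching_number G"
    using maximum_matching_exists[OF pair_finite_arcs] .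
  have disj: "e = e'" if "e \<in> M" "e' \<in> M" "x \<in> e" "x \<in> e'" for e e' x
    using M that unfolding graph_matching_def by blast
  have "card (pverts G - S) = card M"
    using KE card_S card_M SV fin by (simp add: Koenig_Egervary_def card_Diff_subset finite_subset)
  \<comment> \<open>No edge lies inside \<open>S\<close>, so each matching edge can be oriented to
    start at a vertex outside \<open>S\<close>.\<close>
  have "\<forall>e\<in>M. \<exists>v w. e = {v, w} \<and> (v, w) \<in> parcs G \<and> v \<in> pverts G - S"
  proof
    fix e assume "e \<in> M"
    then obtain u v where uv: "e = {u, v}" "(u, v) \<in> parcs G"
      using M unfolding graph_matching_def edge_set_def by blast
    then have "u \<in> pverts G" "v \<in> pverts G" "u \<notin> S \<or> v \<notin> S"
      using S arc_fst_in_verts arc_snd_in_verts by (force simp: independent_set_def)+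
    with uv arcs_symmetric show "\<exists>v w. e = {v, w} \<and> (v, w) \<in> parcs G \<and> v \<in> pverts G - S"
      by blast
  qed
  then obtain g h where gh: "\<And>e. e \<in> M \<Longrightarrow> e = {g e, h e}"
    "\<And>e. e \<in> M \<Longrightarrow> (g e, h e) \<in> parcs G" "\<And>e. e \<in> M \<Longrightarrow> g e \<in> pverts G - S"
    by metis
  have g_in: "g e \<in> e" and h_in: "h e \<in> e" if "e \<in> M" for e
    using gh(1)[OF that] by blast+
  have g_inj: "inj_on g M" and h_inj: "inj_on h M"
    using disj g_in h_in by (metis inj_onI)+
  \<comment> \<open>\<open>g\<close> is injective between finite sets of equal size, so the chosen
    ends exhaust the complement of \<open>S\<close>.\<close>
  have g_img: "g ` M = pverts G - S"
    by (rule card_subset_eq)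
      (use fin gh(3) g_inj \<open>card (pverts G - S) = card M\<close> in \<open>auto simp: card_image\<close>)
  \<comment> \<open>Otherwise \<open>h e\<close> is the chosen end \<open>g e'\<close> of some
    matching edge; the two edges share a vertex, hence coincide, and \<open>e\<close> would be a
    loop.\<close>
  have h_S: "h e \<in> S" if e: "e \<in> M" for e
  proof (rule ccontr)
    assume "h e \<notin> S"
    moreover have "h e \<in> pverts G" using arc_snd_in_verts[OF gh(2)[OF e]] by simp
    ultimately obtain e' where "e' \<in> M" "h e = g e'" using g_img by blast
    then have "h e = g e" using disj[OF e] h_in[OF e] g_in by metis
    then show False using gh(2)[OF e] no_loops' by metis
  qed
  \<comment> \<open>This sends a vertex outside \<open>S\<close> to the other end of the matching
    edge covering it.\<close>
  let ?f = "h \<circ> inv_into M g"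
  have inv_M: "inv_into M g v \<in> M" "g (inv_into M g v) = v" if "v \<in> pverts G - S" for v
    using that g_img by (auto intro: inv_into_into f_inv_into_f)
  show ?thesis
  proof
    show "inj_on ?f (pverts G - S)"
      using inv_M inj_onD[OF h_inj] by (intro inj_onI) (metis comp_apply)
    show "?f ` (pverts G - S) \<subseteq> S"
      using inv_M h_S by auto
    show "(v, ?f v) \<in> parcs G" if "v \<in> pverts G - S" for v
      using gh(2) inv_M[OF that] by (metis comp_apply)
  qed
qed

lemma Koenig_Egervary_maximum_imp_critical:
  assumes KE: "Koenig_Egervary G" and S: "S \<in> maximum_independent_sets G"
  shows "critical_independent_set G S"
proof -
  obtain f where f: "inj_on f (pverts G - S)" "f ` (pverts G - S) \<subseteq> S"
    "\<And>v. v \<in> pverts G - S \<Longrightarrow> (v, f v) \<in> parcs G"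
    using Koenig_Egervary_matching_injection[OF assms] by blast
  from S have S: "independent_set G S"
    by (auto simp: maximum_independent_sets_def)
  note fin = pair_finite_verts
  have SV: "S \<subseteq> pverts G"
    using S by (auto simp: independent_set_def)
  then have finS: "finite S" using finite_subset[OF _ fin] by blast
  let ?C = "pverts G - S"
  have "nbhd G S \<subseteq> ?C"
    using S unfolding independent_set_def nbhd_def by blast
  then have "card (nbhd G S) \<le> card ?C"
    using fin by (intro card_mono) auto
  then have lower: "int (card S) - int (card ?C) \<le> difference G S"
    by (simp add: difference_def)
  have "difference G I \<le> int (card S) - int (card ?C)" if I: "independent_set G I" for I
  proof -
    have IV: "I \<subseteq> pverts G" using I by (simp add: independent_set_def)
    have NV: "nbhd G I \<subseteq> pverts G" by (auto simp: nbhd_def)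
    have finI: "finite I" and finN: "finite (nbhd G I)"
      using IV NV finite_subset[OF _ fin] by blast+
    have "f ` (I - S) \<subseteq> nbhd G I \<inter> S"
      using f IV SV unfolding nbhd_def by blast
    then have 1: "card (I - S) \<le> card (nbhd G I \<inter> S)"
      using finN IV by (intro card_inj_on_le[of f] inj_on_subset[OF f(1)]) auto
    \<comment> \<open>If \<open>x \<in> I \<inter> S\<close> is matched, say \<open>x = f v\<close>,
      then \<open>v\<close> is a neighbour of \<open>x\<close> outside \<open>S\<close>. The
      unmatched vertices of \<open>S\<close> number only |S| - |?C|.\<close>
    have "I \<inter> S \<subseteq> (S - f ` ?C) \<union> f ` (nbhd G I - S)"
    proof
      fix x assume x: "x \<in> I \<inter> S"
      show "x \<in> (S - f ` ?C) \<union> f ` (nbhd G I - S)"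
      proof (cases "x \<in> f ` ?C")
        case True
        then obtain v where v: "v \<in> ?C" "x = f v" by blast
        then have "v \<in> nbhd G I"
          using arcs_symmetric[OF f(3)[OF v(1)]] x unfolding nbhd_def by blast
        with v show ?thesis by blast
      qed (use x in blast)
    qed
    then have "card (I \<inter> S) \<le> card ((S - f ` ?C) \<union> f ` (nbhd G I - S))"
      using finS finN by (intro card_mono) auto
    also have "\<dots> \<le> card (S - f ` ?C) + card (nbhd G I - S)"
      using card_Un_le card_image_le[of "nbhd G I - S" f] finN
      by (meson add_left_mono finite_Diff order_trans)
    finally have 2: "card (I \<inter> S) \<le> card (S - f ` ?C) + card (nbhd G I - S)" .
    have "card (S - f ` ?C) + card ?C = card S"
      using f(2) finS card_image[OF f(1)] card_mono[OF finS f(2)]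
      by (simp add: card_Diff_subset finite_subset)
    moreover have "card I = card (I \<inter> S) + card (I - S)"
      "card (nbhd G I) = card (nbhd G I \<inter> S) + card (nbhd G I - S)"
      using card_Int_Diff finI finN by blast+
    \<comment> \<open>Adding 1 and 2 gives |I| \<le> |N(I)| + |S| - |?C|.\<close>
    ultimately show ?thesis using 1 2 by (simp add: difference_def)
  qed
  with lower S show ?thesis
    by (auto simp: critical_independent_set_iff[OF fin] intro: order_trans)
qed

lemma Koenig_Egervary_diadem_eq_corona:
  assumes "Koenig_Egervary G"
  shows "diadem G = corona G"
  using diadem_subset_corona Koenig_Egervary_maximum_imp_critical[OF assms]
  unfolding diadem_def corona_def by blast

lemma Koenig_Egervary_card_ker_diadem:
  assumes KE: "Koenig_Egervary G"
  shows "card (graph_ker G) + card (diadem G) \<le> 2 * independence_number G"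
proof -
  note fin = pair_finite_verts
  obtain S where S: "S \<in> maximum_independent_sets G"
    using maximum_independent_set_exists[OF fin] .
  obtain f where f: "inj_on f (pverts G - S)" "f ` (pverts G - S) \<subseteq> S"
    "\<And>v. v \<in> pverts G - S \<Longrightarrow> (v, f v) \<in> parcs G"
    using Koenig_Egervary_matching_injection[OF KE S] by blast
  have SV: "S \<subseteq> pverts G" and card_S: "card S = independence_number G"
    using S by (auto simp: maximum_independent_sets_def independent_set_def)
  then have finS: "finite S" using finite_subset[OF _ fin] by blast
  have S_crit: "critical_independent_set G S"
    by (rule Koenig_Egervary_maximum_imp_critical[OF KE S])
  have ker: "graph_ker G \<subseteq> S" and dia: "S \<subseteq> diadem G"
    using S_crit by (auto simp: graph_ker_def diadem_def)
  have diaV: "diadem G \<subseteq> pverts G"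
    by (auto simp: diadem_def critical_independent_set_def independent_set_def)
  have "f ` (diadem G - S) \<subseteq> S - graph_ker G"
  proof
    fix x assume "x \<in> f ` (diadem G - S)"
    then obtain v T where v: "x = f v" "v \<notin> S" "v \<in> T" and T: "critical_independent_set G T"
      by (auto simp: diadem_def)
    have vC: "v \<in> pverts G - S"
      using v T by (auto simp: critical_independent_set_def independent_set_def)
    \<comment> \<open>\<open>T\<close> need only be critical here: it is independent and contains
      the neighbour \<open>v\<close>, and a vertex missed by one critical set is outside the
      kernel.\<close>
    have "f v \<notin> T"
      using T v(3) f(3)[OF vC] by (auto simp: critical_independent_set_def independent_set_def)
    with v vC f(2) T show "x \<in> S - graph_ker G"
      by (auto simp: graph_ker_def)
  qed
  then have "card (diadem G - S) \<le> card (S - graph_ker G)"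
    using finS diaV by (intro card_inj_on_le[of f] inj_on_subset[OF f(1)]) auto
  then have "card (diadem G) - card S \<le> card S - card (graph_ker G)"
    using ker dia finS by (simp add: card_Diff_subset finite_subset)
  \<comment> \<open>Subtraction on \<open>nat\<close> truncates; this makes the right-hand
    difference above exact.\<close>
  moreover have "card (graph_ker G) \<le> card S"
    using ker finS by (rule card_mono[rotated])
  ultimately show ?thesis using card_S by linarith
qed

end

theorem theorem4p1:
  fixes G :: "'a pair_pre_digraph"
  assumes "pair_graph G"
  shows "(diadem G \<subseteq> corona G \<and> (Koenig_Egervary G \<longrightarrow> diadem G = corona G)) \<and>
         (Koenig_Egervary G \<longrightarrow>
            card (graph_ker G) + card (diadem G) \<le> 2 * independence_number G)"
  using pair_graph.diadem_subset_corona[OF assms]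
    pair_graph.Koenig_Egervary_diadem_eq_corona[OF assms]
    pair_graph.Koenig_Egervary_card_ker_diadem[OF assms]
  by blast

end
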